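(* Let $g:\mathbb{R}^m\to\mathbb{R}$ be a convex Fréchet differentiable function with $L_g$-Lipschitz continuous gradient, and assume that $\operatorname{argmin} g\neq\emptyset$. Let $t_0>0$, $u_0,v_0\in\mathbb{R}^m$ and $\beta\ge 0$. Let $x:[t_0,+\infty)\to\mathbb{R}^m$ be the unique strong global solution of the dynamical system $$\ddot{x}(t)+\frac{3}{t}\dot{x}(t)+\nabla g\left(x(t)+\frac{\beta}{t}\dot{x}(t)\right)=0,\qquad x(t_0)=u_0,\ \dot{x}(t_0)=v_0.$$ Then there exist $K\ge 0$ and $t_1\ge t_0$ such that $$g\left(x(t)+\frac{\beta}{t}\dot{x}(t)\right)-\min g\le \frac{K}{t^2}\quad\text{for all }t\ge t_1.$$ Moreover, if $\beta>0$, then $$\int_{t_0}^{+\infty}t\left\|\nabla g\left(x(t)+\frac{\beta}{t}\dot{x}(t)\right)\right\|^2dt<+\infty.$$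
   Context: $\mathbb{R}^m$ carries the Euclidean norm $\|\cdot\|$. That $\nabla g$ is $L_g$-Lipschitz means $L_g\ge 0$ and $\|\nabla g(x)-\nabla g(y)\|\le L_g\|x-y\|$ for all $x,y\in\mathbb{R}^m$. A function $x:[t_0,+\infty)\to\mathbb{R}^m$ is a strong global solution of the dynamical system if: (i) $x$ and $\dot x$ are locally absolutely continuous on $[t_0,+\infty)$ (i.e. absolutely continuous on every compact interval $[t_0,T]$, $T>t_0$); (ii) the differential equation holds for almost every $t\ge t_0$; (iii) $x(t_0)=u_0$ and $\dot x(t_0)=v_0$. Under the stated assumptions such a solution exists and is unique. *)

theory Defs
  imports "HOL-Analysis.Analysis"
begin

definition absolutely_continuous_on_interval ::
    "real \<Rightarrow> real \<Rightarrow> (real \<Rightarrow> 'a::real_normed_vector) \<Rightarrow> bool" where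
  "absolutely_continuous_on_interval a b f \<longleftrightarrow>
     (\<forall>\<epsilon>>0. \<exists>\<delta>>0. \<forall>(n::nat) (l::nat \<Rightarrow> real) (r::nat \<Rightarrow> real).
        (\<forall>i<n. a \<le> l i \<and> l i \<le> r i \<and> r i \<le> b) \<longrightarrow>
        disjoint_family_on (\<lambda>i. {l i<..<r i}) {..<n} \<longrightarrow>
        (\<Sum>i<n. r i - l i) < \<delta> \<longrightarrow>
        (\<Sum>i<n. norm (f (r i) - f (l i))) < \<epsilon>)"

definition locally_absolutely_continuous_from ::
    "real \<Rightarrow> (real \<Rightarrow> 'a::real_normed_vector) \<Rightarrow> bool" where
  "locally_absolutely_continuous_from t0 f \<longleftrightarrow>
     (\<forall>T>t0. absolutely_continuous_on_interval t0 T f)"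

text \<open>
  A function on the half-line is a total function whose values below \<open>t0\<close> are never
  constrained or used; accordingly the derivative at \<open>t0\<close> is the one-sided one.
  The argument \<open>x'\<close> is the velocity, which the first conjunct determines from \<open>x\<close> on the
  half-line, and \<open>G\<close> is the gradient of the potential.
\<close>

definition strong_global_solution ::
    "('a::real_normed_vector \<Rightarrow> 'a) \<Rightarrow> real \<Rightarrow> real \<Rightarrow> 'a \<Rightarrow> 'a \<Rightarrow>
     (real \<Rightarrow> 'a) \<Rightarrow> (real \<Rightarrow> 'a) \<Rightarrow> bool" where
  "strong_global_solution G \<beta> t0 u0 v0 x x' \<longleftrightarrow>
     (\<forall>t\<ge>t0. (x has_vector_derivative x' t) (at t within {t0..})) \<and>
     locally_absolutely_continuous_from t0 x \<and>
     locally_absolutely_continuous_from t0 x' \<and>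
     (AE t in lebesgue. t \<ge> t0 \<longrightarrow>
        (\<exists>x''. (x' has_vector_derivative x'') (at t within {t0..}) \<and>
               x'' + (3 / t) *\<^sub>R x' t + G (x t + (\<beta> / t) *\<^sub>R x' t) = 0)) \<and>
     x t0 = u0 \<and> x' t0 = v0"

end

theory Submission
  imports Defs
begin

text \<open>
  Since the gradient is continuous, the velocity of a strong solution is \<open>C\<^sup>1\<close>: an absolutely
  continuous function is the integral of its almost everywhere derivative, and here that
  derivative agrees with a continuous function. Write \<open>y = x + (\<beta> / t) x'\<close> and let \<open>z\<close> be a
  minimiser. For \<open>t\<^sup>2 > 4 \<beta>\<close> the function
  \<open>E t = a t (g (y t) - g z) + \<parallel>2 (x t - z) + t x' t\<parallel>\<^sup>2 / 2\<close> with
  \<open>a t = t\<^sup>2 (t\<^sup>2 - 2 \<beta>) / (t\<^sup>2 - 4 \<beta>)\<close> satisfies \<open>E' \<le> - \<beta> t \<parallel>\<nabla>g (y t)\<parallel>\<^sup>2\<close>, because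
  \<open>a t \<ge> t\<^sup>2\<close> and \<open>a' t \<le> 2 t\<close>. Monotonicity of \<open>E\<close> gives the rate, integration the
  weighted square integrability of the gradient.
\<close>

section \<open>Absolutely continuous functions as integrals of their derivatives\<close>

lemma absolutely_continuous_on_intervalE:
  assumes "absolutely_continuous_on_interval a b f" "\<epsilon> > 0"
  obtains \<delta> where "\<delta> > 0"
    "\<And>(n::nat) l r. (\<And>i. i < n \<Longrightarrow> a \<le> l i \<and> l i \<le> r i \<and> r i \<le> b) \<Longrightarrow>
      disjoint_family_on (\<lambda>i. {l i<..<r i}) {..<n} \<Longrightarrow>
      (\<Sum>i<n. r i - l i) < \<delta> \<Longrightarrow> (\<Sum>i<n. norm (f (r i) - f (l i))) < \<epsilon>"
  using assms unfolding absolutely_continuous_on_interval_def by blast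

text \<open>The proof works directly with a gauge. On cells tagged outside \<open>N\<close>,
  differentiability controls the error. Cells tagged in \<open>N\<close> are confined to an open set
  so small that, by absolute continuity, the increments of \<open>h\<close> over them have a small
  sum. Integrability of \<open>h'\<close> is part of the conclusion.\<close>

lemma has_integral_absolutely_continuous:
  fixes h :: "real \<Rightarrow> 'a::real_normed_vector"
  assumes ab: "a \<le> b"
    and ac: "absolutely_continuous_on_interval a b h"
    and neg: "negligible N"
    and deriv: "\<And>t. t \<in> {a..b} - N \<Longrightarrow> (h has_vector_derivative h' t) (at t within {a..b})"
  shows "(h' has_integral h b - h a) {a..b}"
proof -
  \<comment> \<open>With value 0 on \<open>N\<close>, cells tagged there contribute nothing to the
    Riemann sum, and only the increments of \<open>h\<close> remain to be bounded.\<close>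
  define k where "k t = (if t \<in> N then 0 else h' t)" for t
  have "(k has_integral h b - h a) {a..b}"
    unfolding has_integral_real
  proof (intro allI impI)
    fix e :: real assume e: "e > 0"
    \<comment> \<open>The \<open>+ 1\<close> keeps the denominator positive when
      \<open>a = b\<close> and makes the second bound strict.\<close>
    define \<eta> where "\<eta> = e / (2 * (b - a + 1))"
    have \<eta>: "\<eta> > 0" "\<eta> * (b - a) < e / 2"
      using e ab by (auto simp: \<eta>_def field_simps)
    obtain \<delta> where \<delta>: "\<delta> > 0" and ac\<delta>:
      "\<And>(n::nat) l r. (\<And>i. i < n \<Longrightarrow> a \<le> l i \<and> l i \<le> r i \<and> r i \<le> b) \<Longrightarrow>
        disjoint_family_on (\<lambda>i. {l i<..<r i}) {..<n} \<Longrightarrow>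
        (\<Sum>i<n. r i - l i) < \<delta> \<Longrightarrow> (\<Sum>i<n. norm (h (r i) - h (l i))) < e / 2"
      using e by (rule absolutely_continuous_on_intervalE[OF ac half_gt_zero]) blast
    have N: "N \<in> null_sets lebesgue"
      using neg by (simp add: negligible_iff_null_sets)
    \<comment> \<open>Outer regularity bounds only \<open>U - N\<close>; since \<open>N\<close> is
      null, \<open>U\<close> itself has measure below \<open>\<delta>\<close>.\<close>
    obtain U where U: "open U" "N \<subseteq> U" "U - N \<in> lmeasurable" "emeasure lebesgue (U - N) < ennreal \<delta>"
      using sets_lebesgue_outer_open[of N \<delta>] N \<delta> by blast
    have U_eq: "emeasure lebesgue U = emeasure lebesgue (U - N)"
      using N U(1) by (simp add: emeasure_Diff_null_set)
    have Um: "U \<in> lmeasurable"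
      by (rule fmeasurableI) (use U U_eq in \<open>auto simp: less_top[symmetric] fmeasurable_def\<close>)
    have U\<delta>: "measure lebesgue U < \<delta>"
      using U(4) Um unfolding U_eq[symmetric]
      by (simp add: emeasure_eq_measure2 ennreal_less_iff)
    have "\<exists>d>0. \<forall>y\<in>{a..b}. norm (y - t) < d \<longrightarrow>
             norm (h y - h t - (y - t) *\<^sub>R h' t) \<le> \<eta> * norm (y - t)" if "t \<in> {a..b} - N" for t
      using deriv[OF that] \<eta> unfolding has_vector_derivative_def has_derivative_within_alt by blast
    then obtain d where d: "\<And>t. t \<in> {a..b} - N \<Longrightarrow> d t > 0"
      "\<And>t y. t \<in> {a..b} - N \<Longrightarrow> y \<in> {a..b} \<Longrightarrow> norm (y - t) < d t \<Longrightarrow>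
             norm (h y - h t - (y - t) *\<^sub>R h' t) \<le> \<eta> * norm (y - t)"
      by metis
    \<comment> \<open>Tags in \<open>N\<close> force their cells into \<open>U\<close>; other tags
      in the interval force them into the range where the linear approximation of \<open>h\<close>
      has relative error \<open>\<eta>\<close>. Tags outside the interval never occur, so
      \<open>UNIV\<close> is a dummy value.\<close>
    define \<gamma> where "\<gamma> t = (if t \<in> N then U else if t \<in> {a..b} then ball t (d t) else UNIV)" for t
    have "gauge \<gamma>"
      using U d(1) by (auto simp: gauge_def \<gamma>_def)
    moreover have "norm ((\<Sum>(t, K)\<in>\<D>. measure lborel K *\<^sub>R k t) - (h b - h a)) < e"
      if D: "\<D> tagged_division_of {a..b}" and fine: "\<gamma> fine \<D>" for \<D>
    proof -
      note tD = tagged_division_ofD[OF D]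
      let ?I = "\<lambda>z. Inf (snd z) :: real" and ?S = "\<lambda>z. Sup (snd z) :: real"
      have K: "K = {Inf K..Sup K}" "Inf K \<le> t" "t \<le> Sup K" "a \<le> Inf K" "Sup K \<le> b" "t \<in> {a..b}"
           "measure lborel K = Sup K - Inf K" "K \<subseteq> \<gamma> t"
        if tK: "(t, K) \<in> \<D>" for t K
      proof -
        obtain u v where uv: "K = {u..v}" using tD(4)[OF tK] by auto
        have "t \<in> K" "K \<subseteq> {a..b}" using tD(2,3)[OF tK] by auto
        then show "K = {Inf K..Sup K}" "Inf K \<le> t" "t \<le> Sup K" "a \<le> Inf K" "Sup K \<le> b" "t \<in> {a..b}"
           "measure lborel K = Sup K - Inf K"
          using uv by auto
        show "K \<subseteq> \<gamma> t" using fine tK by (auto simp: fine_def)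
      qed
      define B where "B = {z \<in> \<D>. fst z \<in> N}"
      have finD: "finite \<D>" and finB: "finite B" using tD(1) by (auto simp: B_def)
      \<comment> \<open>Straddling: the linear approximations at the tag are compared at both
        endpoints of the cell, and the two errors add up to \<open>\<eta>\<close> times its length
        because the tag lies between them.\<close>
      have good: "norm (measure lborel K *\<^sub>R k t - (h (Sup K) - h (Inf K))) \<le> \<eta> * measure lborel K"
        if z: "(t, K) \<in> \<D> - B" for t K
      proof -
        have tK: "(t, K) \<in> \<D>" and tN: "t \<notin> N" using z by (auto simp: B_def)
        note K = K[OF tK]
        have "Inf K \<in> K" "Sup K \<in> K" using K(1-3) by (metis atLeastAtMost_iff order.trans order_refl)+
        then have near: "norm (Inf K - t) < d t" "norm (Sup K - t) < d t"
          using K(6,8) tN by (auto simp: \<gamma>_def dist_norm norm_minus_commute)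
        have 1: "norm (h (Inf K) - h t - (Inf K - t) *\<^sub>R h' t) \<le> \<eta> * (t - Inf K)"
          using d(2)[of t "Inf K"] K tN near by auto
        have 2: "norm (h (Sup K) - h t - (Sup K - t) *\<^sub>R h' t) \<le> \<eta> * (Sup K - t)"
          using d(2)[of t "Sup K"] K tN near by auto
        have "measure lborel K *\<^sub>R k t - (h (Sup K) - h (Inf K)) =
            (h (Inf K) - h t - (Inf K - t) *\<^sub>R h' t) - (h (Sup K) - h t - (Sup K - t) *\<^sub>R h' t)"
          using tN by (simp add: K(7) k_def algebra_simps)
        also have "norm \<dots> \<le> \<eta> * (t - Inf K) + \<eta> * (Sup K - t)"
          by (rule norm_triangle_le_diff) (use 1 2 in linarith)
        also have "\<dots> = \<eta> * measure lborel K" by (simp add: K(7) algebra_simps)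
        finally show ?thesis .
      qed
      have disj: "disjoint_family_on (\<lambda>z. {?I z<..<?S z}) B"
        unfolding disjoint_family_on_def
      proof (intro ballI impI)
        fix z w assume zw: "z \<in> B" "w \<in> B" "z \<noteq> w"
        obtain t K t' K' where eq: "z = (t, K)" "w = (t', K')" by fastforce
        have m: "(t, K) \<in> \<D>" "(t', K') \<in> \<D>" using zw eq by (auto simp: B_def)
        have "interior K \<inter> interior K' = {}" using tD(5)[OF m] zw eq by auto
        moreover have "interior K = {Inf K<..<Sup K}" "interior K' = {Inf K'<..<Sup K'}"
          using K(1)[OF m(1)] K(1)[OF m(2)] by (metis interior_atLeastAtMost_real)+
        ultimately show "{?I z<..<?S z} \<inter> {?I w<..<?S w} = {}" using eq by simp
      qed
      \<comment> \<open>The cells tagged in \<open>N\<close> have disjoint interiors inside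
        \<open>U\<close>, so their total length is below \<open>\<delta>\<close>.\<close>
      have "(\<Sum>z\<in>B. ?S z - ?I z) = (\<Sum>z\<in>B. measure lebesgue {?I z<..<?S z})"
        using K(2,3) by (intro sum.cong) (fastforce simp: B_def)+
      also have "\<dots> = measure lebesgue (\<Union>z\<in>B. {?I z<..<?S z})"
      proof (rule measure_finite_Union[symmetric, OF finB _ disj])
        show "emeasure lebesgue {?I z<..<?S z} \<noteq> \<infinity>" for z :: "real \<times> real set"
          using fmeasurableD2[OF lmeasurable_box] by (metis box_real(1) infinity_ennreal_def)
      qed auto
      also have "\<dots> \<le> measure lebesgue U"
      proof (rule measure_mono_fmeasurable[OF _ _ Um])
        show "(\<Union>z\<in>B. {?I z<..<?S z}) \<subseteq> U"
        proof (rule UN_least)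
          fix z assume z: "z \<in> B"
          obtain t K where eq: "z = (t, K)" by fastforce
          have "(t, K) \<in> \<D>" "t \<in> N" using z eq by (auto simp: B_def)
          then have "{Inf K..Sup K} \<subseteq> U" using K(1,8) by (metis \<gamma>_def)
          then show "{?I z<..<?S z} \<subseteq> U" using eq by auto
        qed
      qed (use finB in auto)
      finally have small: "(\<Sum>z\<in>B. ?S z - ?I z) < \<delta>" using U\<delta> by linarith
      \<comment> \<open>Absolute continuity speaks of families indexed by an initial segment of the
        naturals, so \<open>B\<close> is enumerated.\<close>
      obtain \<phi> where \<phi>: "bij_betw \<phi> {..<card B} B"
        using ex_bij_betw_nat_finite[OF finB] by (auto simp: atLeast0LessThan)
      have "(\<Sum>i<card B. norm (h (?S (\<phi> i)) - h (?I (\<phi> i)))) < e / 2"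
      proof (rule ac\<delta>)
        fix i assume "i < card B"
        show "a \<le> ?I (\<phi> i) \<and> ?I (\<phi> i) \<le> ?S (\<phi> i) \<and> ?S (\<phi> i) \<le> b"
        proof -
          have "\<phi> i \<in> \<D>" using \<open>i < card B\<close> bij_betwE[OF \<phi>] by (auto simp: B_def)
          then show "a \<le> ?I (\<phi> i) \<and> ?I (\<phi> i) \<le> ?S (\<phi> i) \<and> ?S (\<phi> i) \<le> b"
            using K[of "fst (\<phi> i)" "snd (\<phi> i)"] by auto
        qed
      next
        show "disjoint_family_on (\<lambda>i. {?I (\<phi> i)<..<?S (\<phi> i)}) {..<card B}"
          using disj \<phi> unfolding disjoint_family_on_def bij_betw_def inj_on_def by (metis imageI)
        show "(\<Sum>i<card B. ?S (\<phi> i) - ?I (\<phi> i)) < \<delta>"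
          using small sum.reindex_bij_betw[OF \<phi>, of "\<lambda>z. ?S z - ?I z"] by simp
      qed
      then have bad: "(\<Sum>z\<in>B. norm (h (?S z) - h (?I z))) < e / 2"
        using sum.reindex_bij_betw[OF \<phi>, of "\<lambda>z. norm (h (?S z) - h (?I z))"] by simp
      let ?f = "\<lambda>(t, K). measure lborel K *\<^sub>R k t - (h (Sup K) - h (Inf K))"
      \<comment> \<open>The increments of \<open>h\<close> telescope over the tagged division to
        \<open>h b - h a\<close>, so the error splits cell by cell.\<close>
      have "(\<Sum>(t, K)\<in>\<D>. measure lborel K *\<^sub>R k t) - (h b - h a) = sum ?f \<D>"
        unfolding additive_tagged_division_1[OF ab D, of h, symmetric] sum_subtractf[symmetric]
        by (simp add: split_def)
      also have "\<dots> = sum ?f (\<D> - B) + sum ?f B"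
        using finD by (intro sum.subset_diff) (auto simp: B_def)
      also have "norm \<dots> \<le> (\<Sum>z\<in>\<D> - B. \<eta> * measure lborel (snd z)) + (\<Sum>z\<in>B. norm (h (?S z) - h (?I z)))"
      proof (rule norm_triangle_mono)
        show "norm (sum ?f (\<D> - B)) \<le> (\<Sum>z\<in>\<D> - B. \<eta> * measure lborel (snd z))"
          by (rule sum_norm_le) (use good in auto)
        show "norm (sum ?f B) \<le> (\<Sum>z\<in>B. norm (h (?S z) - h (?I z)))"
          by (rule sum_norm_le) (auto simp: B_def k_def norm_minus_commute)
      qed
      also have "(\<Sum>z\<in>\<D> - B. \<eta> * measure lborel (snd z)) \<le> (\<Sum>z\<in>\<D>. \<eta> * measure lborel (snd z))"
        using \<eta> finD by (intro sum_mono2) auto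
      also have "\<dots> = \<eta> * (b - a)"
        using additive_content_tagged_division[of \<D> a b] D ab
        by (simp add: sum_distrib_left[symmetric] split_def)
      finally show ?thesis using bad \<eta>(2) by linarith
    qed
    ultimately show "\<exists>\<gamma>. gauge \<gamma> \<and> (\<forall>\<D>. \<D> tagged_division_of {a..b} \<and> \<gamma> fine \<D> \<longrightarrow>
        norm ((\<Sum>(t, K)\<in>\<D>. measure lborel K *\<^sub>R k t) - (h b - h a)) < e)"
      by (intro exI[of _ \<gamma>]) simp
  qed
  then show ?thesis
    by (rule has_integral_spike[OF neg, rotated]) (simp add: k_def)
qed

lemma absolutely_continuous_on_interval_subset:
  assumes "absolutely_continuous_on_interval a b f" "a \<le> c" "d \<le> b"
  shows "absolutely_continuous_on_interval c d f"
  unfolding absolutely_continuous_on_interval_def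
proof (intro allI impI)
  fix \<epsilon> :: real assume "\<epsilon> > 0"
  with assms(1) obtain \<delta> where \<delta>: "\<delta> > 0" "\<And>(n::nat) l r. (\<And>i. i < n \<Longrightarrow> a \<le> l i \<and> l i \<le> r i \<and> r i \<le> b) \<Longrightarrow>
        disjoint_family_on (\<lambda>i. {l i<..<r i}) {..<n} \<Longrightarrow>
        (\<Sum>i<n. r i - l i) < \<delta> \<Longrightarrow> (\<Sum>i<n. norm (f (r i) - f (l i))) < \<epsilon>"
    by (rule absolutely_continuous_on_intervalE) blast
  show "\<exists>\<delta>>0. \<forall>(n::nat) l r. (\<forall>i<n. c \<le> l i \<and> l i \<le> r i \<and> r i \<le> d) \<longrightarrow>
        disjoint_family_on (\<lambda>i. {l i<..<r i}) {..<n} \<longrightarrow>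
        (\<Sum>i<n. r i - l i) < \<delta> \<longrightarrow> (\<Sum>i<n. norm (f (r i) - f (l i))) < \<epsilon>"
    using \<delta> assms(2,3) by (intro exI[of _ \<delta>]) (force intro!: \<delta>(2))
qed

text \<open>A family consisting of the single interval between the two points suffices.\<close>

lemma absolutely_continuous_on_interval_imp_continuous_on:
  fixes f :: "real \<Rightarrow> 'a::real_normed_vector"
  assumes "absolutely_continuous_on_interval a b f"
  shows "continuous_on {a..b} f"
  unfolding continuous_on_iff
proof (intro ballI allI impI)
  fix x e :: real assume x: "x \<in> {a..b}" and "e > 0"
  obtain \<delta> where \<delta>: "\<delta> > 0" "\<And>(n::nat) l r. (\<And>i. i < n \<Longrightarrow> a \<le> l i \<and> l i \<le> r i \<and> r i \<le> b) \<Longrightarrow>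
        disjoint_family_on (\<lambda>i. {l i<..<r i}) {..<n} \<Longrightarrow>
        (\<Sum>i<n. r i - l i) < \<delta> \<Longrightarrow> (\<Sum>i<n. norm (f (r i) - f (l i))) < e"
    using \<open>e > 0\<close> by (rule absolutely_continuous_on_intervalE[OF assms]) blast
  have "dist (f y) (f x) < e" if "y \<in> {a..b}" "dist y x < \<delta>" for y
    using \<delta>(2)[of 1 "\<lambda>_. min x y" "\<lambda>_. max x y"] x that
    by (cases "x \<le> y") (auto simp: disjoint_family_on_def dist_norm norm_minus_commute)
  then show "\<exists>d>0. \<forall>y\<in>{a..b}. dist y x < d \<longrightarrow> dist (f y) (f x) < e"
    using \<delta>(1) by blast
qed

text \<open>By the preceding integral formula \<open>h\<close> is \<open>h a\<close> plus the
  integral of \<open>f\<close> from \<open>a\<close>, and the integral of a continuous function is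
  differentiable at every point. The exceptional null set thus disappears.\<close>

lemma has_vector_derivative_of_continuous_ae_derivative:
  fixes h :: "real \<Rightarrow> 'a::banach"
  assumes ac: "absolutely_continuous_on_interval a b h"
    and cont: "continuous_on {a..b} f"
    and ae: "AE t in lebesgue. t \<in> {a..b} \<longrightarrow> (h has_vector_derivative f t) (at t within {a..b})"
    and t: "t \<in> {a..b}"
  shows "(h has_vector_derivative f t) (at t within {a..b})"
proof -
  obtain N where N: "N \<in> null_sets lebesgue"
    "\<And>s. s \<in> space lebesgue - N \<Longrightarrow> s \<in> {a..b} \<longrightarrow> (h has_vector_derivative f s) (at s within {a..b})"
    using AE_E3[OF ae] by blast
  have int: "(f has_integral h u - h a) {a..u}" if u: "u \<in> {a..b}" for u
  proof (rule has_integral_absolutely_continuous[where N = N])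
    show "absolutely_continuous_on_interval a u h"
      using ac u by (auto intro: absolutely_continuous_on_interval_subset)
    show "(h has_vector_derivative f s) (at s within {a..u})" if "s \<in> {a..u} - N" for s
      by (rule has_vector_derivative_within_subset[OF N(2)[rule_format]]) (use that u in auto)
  qed (use u N(1) in \<open>auto simp: negligible_iff_null_sets\<close>)
  then have h: "h a + integral {a..u} f = h u" if "u \<in> {a..b}" for u
    using integral_unique[OF int[OF that]] by simp
  have "((\<lambda>u. h a + integral {a..u} f) has_vector_derivative f t) (at t within {a..b})"
    using integral_has_vector_derivative[OF cont t] by (auto intro!: derivative_eq_intros)
  then show ?thesis
    using h by (intro has_vector_derivative_transform[OF t, of h]) auto
qed

section \<open>Regularity of strong solutions\<close>

text \<open>The differential equation is upgraded from almost every to every time: solved for the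
  acceleration, its right-hand side is continuous in time.\<close>

lemma strong_global_solution_acceleration:
  fixes x x' :: "real \<Rightarrow> 'a::banach"
  assumes sol: "strong_global_solution G \<beta> t0 u0 v0 x x'"
    and G: "continuous_on UNIV G" and t0: "t0 > 0" and t: "t \<in> {t0..T}"
  shows "(x' has_vector_derivative - (3 / t) *\<^sub>R x' t - G (x t + (\<beta> / t) *\<^sub>R x' t))
    (at t within {t0..T})"
proof -
  let ?f = "\<lambda>t. - (3 / t) *\<^sub>R x' t - G (x t + (\<beta> / t) *\<^sub>R x' t)"
  \<comment> \<open>The interval is enlarged to \<open>T + 1\<close> because local absolute
    continuity concerns right endpoints strictly beyond \<open>t0\<close>, whereas
    \<open>T = t0\<close> is allowed here.\<close>
  have ac: "absolutely_continuous_on_interval t0 (T + 1) x" "absolutely_continuous_on_interval t0 (T + 1) x'"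
    using sol t by (auto simp: strong_global_solution_def locally_absolutely_continuous_from_def)
  note c = ac[THEN absolutely_continuous_on_interval_imp_continuous_on]
  have "(x' has_vector_derivative ?f t) (at t within {t0..T + 1})"
  proof (rule has_vector_derivative_of_continuous_ae_derivative[OF ac(2)])
    show "continuous_on {t0..T + 1} ?f"
      using t0 by (intro continuous_intros c continuous_on_compose2[OF G]) auto
    have "AE t in lebesgue. t \<ge> t0 \<longrightarrow>
        (\<exists>x''. (x' has_vector_derivative x'') (at t within {t0..}) \<and>
               x'' + (3 / t) *\<^sub>R x' t + G (x t + (\<beta> / t) *\<^sub>R x' t) = 0)"
      using sol by (auto simp: strong_global_solution_def)
    then show "AE t in lebesgue. t \<in> {t0..T + 1} \<longrightarrow> (x' has_vector_derivative ?f t) (at t within {t0..T + 1})"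
    proof (eventually_elim, intro impI)
      fix s assume s: "s \<in> {t0..T + 1}" and "t0 \<le> s \<longrightarrow>
        (\<exists>x''. (x' has_vector_derivative x'') (at s within {t0..}) \<and>
               x'' + (3 / s) *\<^sub>R x' s + G (x s + (\<beta> / s) *\<^sub>R x' s) = 0)"
      then obtain x'' where x'': "(x' has_vector_derivative x'') (at s within {t0..})"
        "x'' + (3 / s) *\<^sub>R x' s + G (x s + (\<beta> / s) *\<^sub>R x' s) = 0"
        by auto
      have "x'' = ?f s"
        using x''(2) by (simp add: algebra_simps eq_neg_iff_add_eq_0)
      then show "(x' has_vector_derivative ?f s) (at s within {t0..T + 1})"
        using x''(1) by (auto intro: has_vector_derivative_within_subset)
    qed
  qed (use t in auto)
  then show ?thesis
    by (rule has_vector_derivative_within_subset) auto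
qed

section \<open>Tangent inequality and integrability on a half-line\<close>

text \<open>Restricting \<open>g\<close> to the line through \<open>z\<close> and \<open>w\<close>
  reduces this to the tangent inequality for a convex function of one variable, taken at 0 and
  evaluated at 1.\<close>

lemma convex_on_above_gradient:
  assumes convex: "convex_on UNIV g" and grad: "GDERIV g z :> d"
  shows "g w \<ge> g z + d \<bullet> (w - z)"
proof -
  define \<phi> where "\<phi> s = g (z + s *\<^sub>R (w - z))" for s :: real
  have "convex_on UNIV \<phi>"
  proof (rule convex_onI)
    fix t u v :: real assume t: "0 < t" "t < 1"
    have "z + ((1 - t) *\<^sub>R u + t *\<^sub>R v) *\<^sub>R (w - z) =
        (1 - t) *\<^sub>R (z + u *\<^sub>R (w - z)) + t *\<^sub>R (z + v *\<^sub>R (w - z))"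
      by (simp add: algebra_simps)
    then show "\<phi> ((1 - t) *\<^sub>R u + t *\<^sub>R v) \<le> (1 - t) * \<phi> u + t * \<phi> v"
      using convex_onD[OF convex, of t] t by (simp add: \<phi>_def)
  qed simp
  moreover have "(\<phi> has_field_derivative d \<bullet> (w - z)) (at 0)"
  proof -
    have g: "(g has_derivative (\<lambda>h. h \<bullet> d)) (at (z + 0 *\<^sub>R (w - z)))"
      using grad by (simp add: gderiv_def)
    have "((\<lambda>s. z + s *\<^sub>R (w - z)) has_derivative (\<lambda>h. h *\<^sub>R (w - z))) (at 0)"
      by (auto intro!: derivative_eq_intros)
    from diff_chain_at[OF this g] show ?thesis
      unfolding has_field_derivative_def \<phi>_def o_def
      by (simp add: inner_commute mult_commute_abs)
  qed
  ultimately have "\<phi> 1 - \<phi> 0 \<ge> (d \<bullet> (w - z)) * (1 - 0)"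
    by (intro convex_on_imp_above_tangent[where A = UNIV]) auto
  then show ?thesis by (simp add: \<phi>_def)
qed

text \<open>Monotone convergence applied to the truncations of \<open>f\<close> to
  \<open>{a..a + k}\<close>, whose integrals are bounded by \<open>B\<close>.\<close>

lemma absolutely_integrable_on_atLeast_bounded:
  fixes f :: "real \<Rightarrow> real"
  assumes int: "\<And>T. T \<ge> a \<Longrightarrow> f integrable_on {a..T}"
    and nonneg: "\<And>t. t \<ge> a \<Longrightarrow> f t \<ge> 0"
    and bound: "\<And>T. T \<ge> a \<Longrightarrow> integral {a..T} f \<le> B"
  shows "f absolutely_integrable_on {a..}"
proof (rule nonnegative_absolutely_integrable_1)
  let ?f = "\<lambda>(k::nat) t. if t \<in> {a..a + real k} then f t else 0"
  have eq: "integral {a..} (?f k) = integral {a..a + real k} f" for k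
    by (subst integral_restrict_Int) (auto simp: Int_absorb1 intro!: arg_cong2[where f = integral])
  have "f integrable_on {a..} \<and> ((\<lambda>k. integral {a..} (?f k)) \<longlonglongrightarrow> integral {a..} f)"
  proof (rule monotone_convergence_increasing)
    show "?f k integrable_on {a..}" for k
      using int[of "a + real k"] by (subst integrable_restrict_Int) (auto simp: Int_absorb2)
    show "?f k t \<le> ?f (Suc k) t" if "t \<in> {a..}" for k t
      using nonneg that by auto
    show "(\<lambda>k. ?f k t) \<longlonglongrightarrow> f t" if "t \<in> {a..}" for t
    proof (rule tendsto_eventually)
      obtain n where "t - a \<le> real n" using real_arch_simple by blast
      then show "\<forall>\<^sub>F k in sequentially. ?f k t = f t"
        using that by (intro eventually_sequentiallyI[of n]) auto
    qed
    have "0 \<le> integral {a..a + real k} f \<and> integral {a..a + real k} f \<le> B" for k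
      using bound int nonneg by (auto intro!: integral_nonneg)
    then show "bounded (range (\<lambda>k. integral {a..} (?f k)))"
      unfolding eq by (intro boundedI[of _ B]) auto
  qed
  then show "f integrable_on {a..}" by blast
qed (use nonneg in auto)

section \<open>Lyapunov analysis for large times\<close>

context
  fixes g :: "'a::euclidean_space \<Rightarrow> real" and G :: "'a \<Rightarrow> 'a"
    and x x' y :: "real \<Rightarrow> 'a" and z :: 'a and \<beta> t1 :: real and a E :: "real \<Rightarrow> real"
  assumes convex: "convex_on UNIV g"
    and gradient: "\<And>w. GDERIV g w :> G w"
    and G_cont: "continuous_on UNIV G"
    and min: "\<And>w. g z \<le> g w"
    and beta: "\<beta> \<ge> 0" and t1: "t1 > 0" "t1\<^sup>2 > 4 * \<beta>"
    and dx: "\<And>t T. t \<in> {t1..T} \<Longrightarrow> (x has_vector_derivative x' t) (at t within {t1..T})"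
    and dx': "\<And>t T. t \<in> {t1..T} \<Longrightarrow>
      (x' has_vector_derivative - (3 / t) *\<^sub>R x' t - G (x t + (\<beta> / t) *\<^sub>R x' t)) (at t within {t1..T})"
  defines "y \<equiv> \<lambda>t. x t + (\<beta> / t) *\<^sub>R x' t"
    and "a \<equiv> \<lambda>t. t\<^sup>2 + 2 * \<beta> + 8 * \<beta>\<^sup>2 / (t\<^sup>2 - 4 * \<beta>)"
    \<comment> \<open>\<open>a\<close> solves \<open>a t * (1 - 4 * \<beta> / t\<^sup>2) = t\<^sup>2 - 2 * \<beta>\<close>, which makes the terms
      \<open>G (y t) \<bullet> x' t\<close> cancel in the derivative of \<open>E\<close>.\<close>
    and "E \<equiv> \<lambda>t. a t * (g (y t) - g z) + (norm (2 *\<^sub>R (x t - z) + t *\<^sub>R x' t))\<^sup>2 / 2"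
begin

lemma time_sq_gt: "t \<ge> t1 \<Longrightarrow> t\<^sup>2 > 4 * \<beta>"
  using t1 power_mono[of t1 t 2] by linarith

text \<open>In the partial fraction form of \<open>a\<close> both terms added to
  \<open>t\<^sup>2\<close> are nonnegative.\<close>

lemma weight_ge: "t \<ge> t1 \<Longrightarrow> a t \<ge> t\<^sup>2"
  using time_sq_gt[of t] beta by (simp add: a_def)

text \<open>After the equation is inserted, the velocity terms from the two summands of
  \<open>E\<close> leave \<open>- 2 * \<beta> * p\<close>. This is just what completes
  \<open>- 2 * t * q\<close> to a multiple of the quantity that convexity bounds below by the gap
  \<open>w\<close>.\<close>

lemma lyapunov_derivative:
  assumes t: "t \<in> {t1..T}"
  obtains E' where "(E has_vector_derivative E') (at t within {t1..T})"
    "\<beta> * (t * (norm (G (y t)))\<^sup>2) \<le> - E'"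
proof -
  have t': "t > 0" "t1 \<le> t" using t t1 by auto
  define D where "D = t\<^sup>2 - 4 * \<beta>"
  have D: "D > 0" using time_sq_gt[OF t'(2)] by (simp add: D_def)
  \<comment> \<open>The correction to \<open>2 * t\<close> comes from the fraction in
    \<open>a\<close> and is nonpositive, whence \<open>a' \<le> 2 * t\<close>.\<close>
  define a' where "a' = 2 * t - 16 * \<beta>\<^sup>2 * t / D\<^sup>2"
  define x'' where "x'' = - (3 / t) *\<^sub>R x' t - G (y t)"
  define y' where "y' = x' t + ((\<beta> / t) *\<^sub>R x'' - (\<beta> / t\<^sup>2) *\<^sub>R x' t)"
  have y_eq: "y t = x t + (\<beta> / t) *\<^sub>R x' t" by (simp add: y_def)
  note dx = dx[OF t] and dx' = dx'[OF t, folded y_eq]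
  have da: "(a has_real_derivative a') (at t within {t1..T})"
    unfolding a_def a'_def D_def using D
    by (auto intro!: derivative_eq_intros simp: D_def power2_eq_square)
  have dbt: "((\<lambda>t. \<beta> / t) has_real_derivative - (\<beta> / t\<^sup>2)) (at t within {t1..T})"
    using t' by (auto intro!: derivative_eq_intros simp: power2_eq_square)
  have dy: "(y has_vector_derivative y') (at t within {t1..T})"
    using has_vector_derivative_add[OF dx has_vector_derivative_scaleR[OF dbt dx']]
    by (simp add: y_def y'_def x''_def)
  have dgy: "((\<lambda>t. g (y t)) has_real_derivative G (y t) \<bullet> y') (at t within {t1..T})"
  proof -
    have "(g has_derivative (\<lambda>h. h \<bullet> G (y t))) (at (y t))"
      using gradient by (simp add: gderiv_def)
    from diff_chain_within[OF dy[unfolded has_vector_derivative_def] has_derivative_at_withinI[OF this]]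
    show ?thesis
      by (simp add: has_field_derivative_def o_def inner_commute mult_commute_abs)
  qed
  define v v' where "v = 2 *\<^sub>R (x t - z) + t *\<^sub>R x' t" and "v' = 2 *\<^sub>R x' t + (t *\<^sub>R x'' + x' t)"
  have dv: "((\<lambda>t. 2 *\<^sub>R (x t - z) + t *\<^sub>R x' t) has_derivative (\<lambda>h. h *\<^sub>R v')) (at t within {t1..T})"
    using dx dx' unfolding has_vector_derivative_def
    by (auto intro!: derivative_eq_intros simp: v'_def x''_def algebra_simps)
  \<comment> \<open>The factor 2 in \<open>v\<close> matches the damping \<open>3 / t\<close>: the
    velocity terms of \<open>v'\<close> add up to three and cancel the damping in
    \<open>t *\<^sub>R x''\<close>.\<close>
  have v': "v' = - (t *\<^sub>R G (y t))"
    using t' scaleR_left_distrib[of 1 2 "x' t"] by (simp add: v'_def x''_def algebra_simps)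
  define E' where "E' = (a' * (g (y t) - g z) + a t * (G (y t) \<bullet> y')) + v \<bullet> v'"
  have "((\<lambda>t. a t * (g (y t) - g z)) has_real_derivative a' * (g (y t) - g z) + a t * (G (y t) \<bullet> y'))
      (at t within {t1..T})"
    using da dgy by (auto intro!: derivative_eq_intros)
  moreover have "((\<lambda>t. (norm (2 *\<^sub>R (x t - z) + t *\<^sub>R x' t))\<^sup>2 / 2) has_real_derivative v \<bullet> v')
      (at t within {t1..T})"
  proof -
    have "((\<lambda>t. ((2 *\<^sub>R (x t - z) + t *\<^sub>R x' t) \<bullet> (2 *\<^sub>R (x t - z) + t *\<^sub>R x' t)) / 2)
        has_derivative (\<lambda>h. (v \<bullet> (h *\<^sub>R v') + (h *\<^sub>R v') \<bullet> v) / 2)) (at t within {t1..T})"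
      unfolding v_def by (rule bounded_linear.has_derivative[OF bounded_linear_divide has_derivative_inner[OF dv dv]])
    moreover have "(\<lambda>h. (v \<bullet> (h *\<^sub>R v') + (h *\<^sub>R v') \<bullet> v) / 2) = (*) (v \<bullet> v')"
      by (auto simp: inner_commute)
    ultimately show ?thesis
      by (simp add: has_field_derivative_def power2_norm_eq_inner)
  qed
  ultimately have dE: "(E has_vector_derivative E') (at t within {t1..T})"
    unfolding has_real_derivative_iff_has_vector_derivative[symmetric] E_def E'_def
    by (rule DERIV_add)
  define p q r w where "p = G (y t) \<bullet> x' t" and "q = G (y t) \<bullet> (x t - z)"
    and "r = (norm (G (y t)))\<^sup>2" and "w = g (y t) - g z"
  have w: "w \<ge> 0" using min by (simp add: w_def)
  have r: "r \<ge> 0" and r_inner: "r = G (y t) \<bullet> G (y t)"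
    by (simp_all add: r_def power2_norm_eq_inner)
  \<comment> \<open>Tangent inequality at \<open>y t\<close>, evaluated at the minimiser;
    \<open>y t - z\<close> splits into \<open>x t - z\<close> and the velocity term.\<close>
  have conv: "w \<le> q + \<beta> / t * p"
    using convex_on_above_gradient[OF convex gradient, of "y t" z]
    by (simp add: w_def q_def p_def y_def inner_diff_right inner_add_right)
  have a_eq: "a t * (1 - 4 * \<beta> / t\<^sup>2) = t\<^sup>2 - 2 * \<beta>"
  proof -
    have "1 - 4 * \<beta> / t\<^sup>2 = D / t\<^sup>2" using t' by (simp add: D_def diff_divide_distrib)
    moreover have "a t * D = (t\<^sup>2 - 2 * \<beta>) * t\<^sup>2"
      using D unfolding a_def D_def[symmetric]
      by (simp add: distrib_right) (simp add: D_def algebra_simps power2_eq_square)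
    ultimately show ?thesis using t' by (simp only: times_divide_eq_right) simp
  qed
  \<comment> \<open>Of the 4, three come from the damping in \<open>x''\<close> and one from the
    derivative of \<open>\<beta> / t\<close>.\<close>
  have "G (y t) \<bullet> y' = (1 - 4 * \<beta> / t\<^sup>2) * p - \<beta> / t * r"
    using t' by (simp add: y'_def x''_def p_def r_inner inner_add_right inner_diff_right
        field_simps power2_eq_square)
  then have "a t * (G (y t) \<bullet> y') = (t\<^sup>2 - 2 * \<beta>) * p - a t * (\<beta> / t * r)"
    using a_eq by (simp add: right_diff_distrib mult.assoc[symmetric])
  moreover have "v \<bullet> v' = - (2 * t * q) - t\<^sup>2 * p"
    by (simp add: v' v_def p_def q_def inner_add_left inner_add_right inner_commute algebra_simps power2_eq_square)
  ultimately have "E' = a' * w + (t\<^sup>2 - 2 * \<beta>) * p - a t * (\<beta> / t * r) - 2 * t * q - t\<^sup>2 * p"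
    by (simp add: E'_def w_def)
  also have "\<dots> = a' * w - 2 * t * (q + \<beta> / t * p) - a t * (\<beta> / t * r)"
    using t' by (simp add: field_simps)
  \<comment> \<open>Three bounds enter: \<open>a' \<le> 2 * t\<close> with \<open>w \<ge> 0\<close>,
    the convexity estimate, and \<open>a t \<ge> t\<^sup>2\<close> with
    \<open>r \<ge> 0\<close>.\<close>
  also have "\<dots> \<le> 2 * t * w - 2 * t * w - t\<^sup>2 * (\<beta> / t * r)"
  proof (intro diff_mono mult_right_mono mult_left_mono)
    show "a' \<le> 2 * t" using t' by (simp add: a'_def)
  qed (use t' w r conv beta weight_ge[of t] in auto)
  also have "\<dots> = - (\<beta> * (t * r))" using t' by (simp add: power2_eq_square)
  finally show thesis by (intro that[OF dE]) (simp add: r_def)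
qed

lemma dissipation_continuous: "continuous_on {t1..T} (\<lambda>t. t * (norm (G (y t)))\<^sup>2)"
proof -
  have "continuous_on {t1..T} x" "continuous_on {t1..T} x'"
    using continuous_on_vector_derivative[OF dx] continuous_on_vector_derivative[OF dx'] by blast+
  then show ?thesis
    unfolding y_def using t1 by (intro continuous_intros continuous_on_compose2[OF G_cont]) auto
qed

text \<open>Integrates the pointwise bound. The fundamental theorem for the gauge integral asks only
  for a derivative at every point, so a pointwise choice of \<open>E'\<close> suffices.\<close>

lemma lyapunov_dissipation:
  assumes T: "T \<ge> t1"
  shows "\<beta> * integral {t1..T} (\<lambda>t. t * (norm (G (y t)))\<^sup>2) \<le> E t1 - E T"
proof -
  have "\<forall>t\<in>{t1..T}. \<exists>E'. (E has_vector_derivative E') (at t within {t1..T}) \<and>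
    \<beta> * (t * (norm (G (y t)))\<^sup>2) \<le> - E'"
    using lyapunov_derivative by metis
  then obtain E' where E': "\<And>t. t \<in> {t1..T} \<Longrightarrow> (E has_vector_derivative E' t) (at t within {t1..T})"
    "\<And>t. t \<in> {t1..T} \<Longrightarrow> \<beta> * (t * (norm (G (y t)))\<^sup>2) \<le> - E' t"
    by metis
  have dE: "((\<lambda>t. - E' t) has_integral - (E T - E t1)) {t1..T}"
    using fundamental_theorem_of_calculus[OF T E'(1)] by (rule has_integral_neg)
  have "((\<lambda>t. \<beta> * (t * (norm (G (y t)))\<^sup>2)) has_integral
      \<beta> * integral {t1..T} (\<lambda>t. t * (norm (G (y t)))\<^sup>2)) {t1..T}"
    by (intro has_integral_mult_right integrable_integral integrable_continuous_real dissipation_continuous)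
  from has_integral_le[OF this dE E'(2)] show ?thesis by simp
qed

text \<open>The square in \<open>E\<close> is dropped and the weight estimate applied. As
  \<open>z\<close> is a minimiser, \<open>E t \<ge> 0\<close> follows.\<close>

lemma lyapunov_nonneg: "t \<ge> t1 \<Longrightarrow> t\<^sup>2 * (g (y t) - g z) \<le> E t"
  using weight_ge[of t] min[of "y t"] by (simp add: E_def add_increasing2 mult_right_mono)

lemma value_rate:
  assumes t: "t \<ge> t1"
  shows "g (y t) - g z \<le> E t1 / t\<^sup>2"
proof -
  have "integral {t1..t} (\<lambda>t. t * (norm (G (y t)))\<^sup>2) \<ge> 0"
    using t1 by (intro integral_nonneg integrable_continuous_real dissipation_continuous) auto
  then have "E t \<le> E t1"
    using lyapunov_dissipation[OF t] beta by (smt (verit) mult_nonneg_nonneg)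
  then show ?thesis
    using lyapunov_nonneg[OF t] t t1 by (simp add: field_simps)
qed

text \<open>Since \<open>E T \<ge> 0\<close>, the total dissipation is at most \<open>E t1\<close>;
  dividing by \<open>\<beta>\<close> bounds the integrals uniformly in \<open>T\<close>.\<close>

lemma gradient_integrable:
  assumes "\<beta> > 0"
  shows "(\<lambda>t. t * (norm (G (y t)))\<^sup>2) absolutely_integrable_on {t1..}"
proof (rule absolutely_integrable_on_atLeast_bounded)
  fix T assume T: "T \<ge> t1"
  have "0 \<le> T\<^sup>2 * (g (y T) - g z)" using min by simp
  then have "\<beta> * integral {t1..T} (\<lambda>t. t * (norm (G (y t)))\<^sup>2) \<le> E t1"
    using lyapunov_dissipation[OF T] lyapunov_nonneg[OF T] by linarith
  then show "integral {t1..T} (\<lambda>t. t * (norm (G (y t)))\<^sup>2) \<le> E t1 / \<beta>"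
    using assms by (simp add: field_simps)
qed (use t1 in \<open>auto intro!: integrable_continuous_real dissipation_continuous\<close>)

end

section \<open>Convergence rate and integrability on the whole half-line\<close>

theorem mainTheorem5:
  fixes g :: "real ^ 'm \<Rightarrow> real"
    and gradg :: "real ^ 'm \<Rightarrow> real ^ 'm"
    and L t0 \<beta> :: real
    and u0 v0 :: "real ^ 'm"
    and x x' :: "real \<Rightarrow> real ^ 'm"
  assumes convex: "convex_on UNIV g"
    and gradient: "\<And>z. GDERIV g z :> gradg z"
    and lipschitz: "L-lipschitz_on UNIV gradg"
    and argmin_nonempty: "{z. is_arg_min g (\<lambda>_. True) z} \<noteq> {}"
    and t0_pos: "t0 > 0"
    and beta_nonneg: "\<beta> \<ge> 0"
    and solution: "strong_global_solution gradg \<beta> t0 u0 v0 x x'"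
  shows "(\<exists>K\<ge>0. \<exists>t1\<ge>t0. \<forall>t\<ge>t1.
            g (x t + (\<beta> / t) *\<^sub>R x' t) - (INF z. g z) \<le> K / t\<^sup>2) \<and>
         (\<beta> > 0 \<longrightarrow>
            set_integrable lebesgue {t0..}
              (\<lambda>t. t * (norm (gradg (x t + (\<beta> / t) *\<^sub>R x' t)))\<^sup>2))"
proof -
  let ?y = "\<lambda>t. x t + (\<beta> / t) *\<^sub>R x' t"
  obtain z where z: "\<And>w. g z \<le> g w"
    using argmin_nonempty by (auto simp: is_arg_min_linorder)
  have inf: "(INF z. g z) = g z"
    using z by (intro cInf_eq_minimum) auto
  have G: "continuous_on UNIV gradg"
    using lipschitz by (rule lipschitz_on_continuous_on)
  have dx: "(x has_vector_derivative x' t) (at t within {t0..T})" if "t \<in> {t0..T}" for t T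
    using solution that
    by (auto simp: strong_global_solution_def intro: has_vector_derivative_within_subset)
  note dx' = strong_global_solution_acceleration[OF solution G t0_pos]
  \<comment> \<open>As \<open>t1 \<ge> 1\<close>, squaring does not decrease it, so
    \<open>t1\<^sup>2 \<ge> 1 + 4 * \<beta>\<close>.\<close>
  define t1 where "t1 = max t0 (1 + 4 * \<beta>)"
  have t1: "t1 \<ge> t0" "t1 > 0" using t0_pos by (auto simp: t1_def)
  have "1 + 4 * \<beta> \<le> t1" "1 \<le> t1" using beta_nonneg by (auto simp: t1_def)
  then have t1_sq: "t1\<^sup>2 > 4 * \<beta>" using self_le_power[of t1 2] by linarith
  have dx1: "(x has_vector_derivative x' t) (at t within {t1..T})" if "t \<in> {t1..T}" for t T
    by (rule has_vector_derivative_within_subset[OF dx[of t T]]) (use that t1 in auto)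
  have dx1': "(x' has_vector_derivative - (3 / t) *\<^sub>R x' t - gradg (?y t)) (at t within {t1..T})"
    if "t \<in> {t1..T}" for t T
    by (rule has_vector_derivative_within_subset[OF dx'[of t T]]) (use that t1 in auto)
  note lyapunov = convex gradient G z beta_nonneg t1(2) t1_sq dx1 dx1'
  \<comment> \<open>Here \<open>C\<close> is the Lyapunov function at time \<open>t1\<close>; its
    formula is no longer needed, since its sign can be read off from the bound at
    \<open>t1\<close>.\<close>
  obtain C where C: "\<And>t. t \<ge> t1 \<Longrightarrow> g (?y t) - g z \<le> C / t\<^sup>2"
    by (rule that[OF value_rate[OF lyapunov]])
  have "0 \<le> C / t1\<^sup>2"
    using C[of t1] z[of "?y t1"] by linarith
  then have "C \<ge> 0" using t1 by (simp add: zero_le_divide_iff)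
  then have "\<exists>K\<ge>0. \<exists>t1\<ge>t0. \<forall>t\<ge>t1. g (?y t) - (INF z. g z) \<le> K / t\<^sup>2"
    using C t1 inf by auto
  moreover have "set_integrable lebesgue {t0..} (\<lambda>t. t * (norm (gradg (?y t)))\<^sup>2)" if "\<beta> > 0"
  proof -
    let ?f = "\<lambda>t. t * (norm (gradg (?y t)))\<^sup>2"
    \<comment> \<open>The Lyapunov estimate starts only at \<open>t1\<close>; on the compact piece
      before it the integrand is continuous and hence integrable.\<close>
    have "continuous_on {t0..t1} x" "continuous_on {t0..t1} x'"
      using continuous_on_vector_derivative[OF dx] continuous_on_vector_derivative[OF dx'] by blast+
    then have "continuous_on {t0..t1} ?f"
      using t0_pos by (intro continuous_intros continuous_on_compose2[OF G]) auto
    then have "?f absolutely_integrable_on {t0..t1}"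
      by (rule absolutely_integrable_continuous_real)
    moreover have "?f absolutely_integrable_on {t1..}"
      using gradient_integrable[OF lyapunov that] by simp
    ultimately have "?f absolutely_integrable_on ({t0..t1} \<union> {t1..})"
      by (rule set_integrable_Un) auto
    also have "{t0..t1} \<union> {t1..} = {t0..}" using t1 by auto
    finally show ?thesis .
  qed
  ultimately show ?thesis by blast
qed

end
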